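(* Let $s\ge2$ be an integer, and let $\xi$ be the pseudocenter of a matching interval $V$ (a connected component of $[0,\frac{s}{s+1}]\setminus\mathcal{E}$), with shortest even $s$-adic expansion $\xi=.w$. Then the boundary points $\partial V=\{\xi_L,\xi_R\}$ can be obtained from $\xi$ as $$\xi_L=.\overline{\check v v},\qquad \xi_R=.\overline{w},$$ where $v$ is the shortest odd $s$-adic expansion of $1-\xi$ and $\check v$ is the digit-wise negation of $v$. Furthermore, $\check w<v$ and $\check v<w$.
   Context: For fixed integer $s\ge2$ and $\gamma\in\mathbb{R}$, $Q_\gamma:\mathbb{R}\to\mathbb{R}$ is defined by $Q_\gamma(x)=x+1$ if $x\le\gamma$ and $Q_\gamma(x)=1+s(1-x)$ if $x>\gamma$. Write $Q_\gamma^k(\gamma^{\pm}):=\lim_{x\to\gamma^{\pm}}Q_\gamma^k(x)$ and let $(Q_\gamma^k)'(\gamma^\pm)$ be the one-sided derivatives. $Q_\gamma$ satisfies the matching condition with matching exponents $\kappa^\pm$ (positive integers) if $Q_\gamma^{\kappa^-}(\gamma^-)=Q_\gamma^{\kappa^+}(\gamma^+)$ and $(Q_\gamma^{\kappa^-})'(\gamma^-)=(Q_\gamma^{\kappa^+})'(\gamma^+)$. The prematching set is $PM_\gamma:=\{Q_\gamma^j(\gamma^-):1\le j\le\kappa^--1\}\cup\{Q_\gamma^j(\gamma^+):1\le j\le\kappa^+-1\}$. The matching set is the (open) set of $\gamma$ such that $Q_\gamma$ satisfies the matching condition and $\gamma\notin PM_\gamma$; the bifurcation set $\mathcal{E}$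 is its complement in $\mathbb{R}$. An $s$-adic rational is a number $p/s^m$ with $p\in\mathbb{Z}$, $m\ge0$; its denominator is the smallest such power $s^m$. Every matching interval in $[0,\frac{s}{s+1}]$ contains a unique $s$-adic rational of lowest denominator, called its pseudocenter. For a word $u=u_1\dots u_n$ with digits in $\{0,\dots,s-1\}$, $.u=\sum_{i=1}^n u_is^{-i}$, and $.\overline{u}$ is the number with purely periodic base-$s$ expansion $uuu\dots$. "Even" (resp. "odd") expansion means a finite expansion of even (resp. odd) length. $\check u$ is obtained from $u$ by replacing every digit $a$ by $\check a:=s-1-a$. Inequalities between words are lexicographic (decided at the first digit where they differ). *)

theory Defs
  imports "HOL-Analysis.Analysis"
begin

definition Q :: "nat \<Rightarrow> real \<Rightarrow> real \<Rightarrow> real" where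
  "Q s \<gamma> x = (if x \<le> \<gamma> then x + 1 else 1 + real s * (1 - x))"

text \<open>One-sided values and derivatives of the iterates at \<open>\<gamma>\<close>. The derivatives are difference
  quotients against the one-sided limit, not against the value at \<open>\<gamma>\<close>, because an iterate
  may jump there. On each side of \<open>\<gamma>\<close> an iterate is affine near \<open>\<gamma>\<close>, so all these limits exist.\<close>

definition Q_left :: "nat \<Rightarrow> real \<Rightarrow> nat \<Rightarrow> real" where
  "Q_left s \<gamma> k = Lim (at_left \<gamma>) (Q s \<gamma> ^^ k)"

definition Q_right :: "nat \<Rightarrow> real \<Rightarrow> nat \<Rightarrow> real" where
  "Q_right s \<gamma> k = Lim (at_right \<gamma>) (Q s \<gamma> ^^ k)"

definition dQ_left :: "nat \<Rightarrow> real \<Rightarrow> nat \<Rightarrow> real" where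
  "dQ_left s \<gamma> k = Lim (at_left \<gamma>) (\<lambda>x. ((Q s \<gamma> ^^ k) x - Q_left s \<gamma> k) / (x - \<gamma>))"

definition dQ_right :: "nat \<Rightarrow> real \<Rightarrow> nat \<Rightarrow> real" where
  "dQ_right s \<gamma> k = Lim (at_right \<gamma>) (\<lambda>x. ((Q s \<gamma> ^^ k) x - Q_right s \<gamma> k) / (x - \<gamma>))"

definition matching_condition :: "nat \<Rightarrow> real \<Rightarrow> nat \<Rightarrow> nat \<Rightarrow> bool" where
  "matching_condition s \<gamma> \<kappa>m \<kappa>p \<longleftrightarrow> \<kappa>m \<ge> 1 \<and> \<kappa>p \<ge> 1 \<and>
     Q_left s \<gamma> \<kappa>m = Q_right s \<gamma> \<kappa>p \<and> dQ_left s \<gamma> \<kappa>m = dQ_right s \<gamma> \<kappa>p"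

definition prematching_set :: "nat \<Rightarrow> real \<Rightarrow> nat \<Rightarrow> nat \<Rightarrow> real set" where
  "prematching_set s \<gamma> \<kappa>m \<kappa>p =
     {Q_left s \<gamma> j | j. 1 \<le> j \<and> j \<le> \<kappa>m - 1} \<union> {Q_right s \<gamma> j | j. 1 \<le> j \<and> j \<le> \<kappa>p - 1}"

text \<open>If some pair of matching exponents exists, there is one that is least in both
  coordinates. It has the smallest prematching set, so quantifying over all pairs
  is the same as using that pair.\<close>

definition matching_set :: "nat \<Rightarrow> real set" where
  "matching_set s = {\<gamma>. \<exists>\<kappa>m \<kappa>p. matching_condition s \<gamma> \<kappa>m \<kappa>p \<and> \<gamma> \<notin> prematching_set s \<gamma> \<kappa>m \<kappa>p}"

definition bifurcation_set :: "nat \<Rightarrow> real set" where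
  "bifurcation_set s = - matching_set s"

definition matching_interval :: "nat \<Rightarrow> real set \<Rightarrow> bool" where
  "matching_interval s V \<longleftrightarrow> V \<in> components ({0..real s / (real s + 1)} - bifurcation_set s)"

definition sadic_rational :: "nat \<Rightarrow> real \<Rightarrow> bool" where
  "sadic_rational s x \<longleftrightarrow> (\<exists>(p::int) (m::nat). x = of_int p / real s ^ m)"

text \<open>The denominator need not be the reduced one: for \<open>s = 4\<close> the denominator of \<open>1/2\<close> is \<open>4\<close>.\<close>

definition sadic_denom :: "nat \<Rightarrow> real \<Rightarrow> nat" where
  "sadic_denom s x = s ^ (LEAST m. \<exists>p::int. x = of_int p / real s ^ m)"

definition pseudocenter :: "nat \<Rightarrow> real set \<Rightarrow> real \<Rightarrow> bool" where
  "pseudocenter s V \<xi> \<longleftrightarrow> \<xi> \<in> V \<and> sadic_rational s \<xi> \<and>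
     (\<forall>\<eta>\<in>V. sadic_rational s \<eta> \<longrightarrow> sadic_denom s \<xi> \<le> sadic_denom s \<eta>)"

definition word_value :: "nat \<Rightarrow> nat list \<Rightarrow> real" where
  "word_value s u = (\<Sum>i<length u. real (u ! i) / real s ^ Suc i)"

definition periodic_value :: "nat \<Rightarrow> nat list \<Rightarrow> real" where
  "periodic_value s u = (\<Sum>i. real (u ! (i mod length u)) / real s ^ Suc i)"

definition sadic_expansion :: "nat \<Rightarrow> nat list \<Rightarrow> real \<Rightarrow> bool" where
  "sadic_expansion s u x \<longleftrightarrow> set u \<subseteq> {..<s} \<and> x = word_value s u"

definition shortest_even_expansion :: "nat \<Rightarrow> nat list \<Rightarrow> real \<Rightarrow> bool" where
  "shortest_even_expansion s u x \<longleftrightarrow> sadic_expansion s u x \<and> even (length u) \<and>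
     (\<forall>u'. sadic_expansion s u' x \<and> even (length u') \<longrightarrow> length u \<le> length u')"

definition shortest_odd_expansion :: "nat \<Rightarrow> nat list \<Rightarrow> real \<Rightarrow> bool" where
  "shortest_odd_expansion s u x \<longleftrightarrow> sadic_expansion s u x \<and> odd (length u) \<and>
     (\<forall>u'. sadic_expansion s u' x \<and> odd (length u') \<longrightarrow> length u \<le> length u')"

definition word_neg :: "nat \<Rightarrow> nat list \<Rightarrow> nat list" where
  "word_neg s u = map (\<lambda>a. s - 1 - a) u"

text \<open>Words may have different lengths, but the comparison must be decided at a common position;
  in contrast to \<open>lexord\<close>, a proper prefix of a word is not below it.\<close>

definition word_less :: "nat list \<Rightarrow> nat list \<Rightarrow> bool" where
  "word_less u v \<longleftrightarrow>
     (\<exists>i. i < length u \<and> i < length v \<and> take i u = take i v \<and> u ! i < v ! i)"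

end

theory Submission
  imports Defs
begin

text \<open>
  Write \<open>D = -s\<close>. The two branches of \<open>Q\<close> act modulo \<open>1\<close> as the identity and as multiplication by \<open>D\<close>,
  respectively, so a point of either one-sided orbit of \<open>\<gamma>\<close> that has used the decreasing branch
  \<open>j\<close> times has slope \<open>D\<^sup>j\<close> and is congruent to \<open>D\<^sup>j\<gamma>\<close>. The slope thus tells the level \<open>j\<close>, and
  matching means that both orbits meet on the same level. As long as the fractional part of
  \<open>D\<^sup>j\<gamma>\<close> exceeds \<open>\<gamma>\<close>, the two orbits stay apart and swap their order at each level
  (\<open>separated_Suc\<close>); as soon as it falls below \<open>\<gamma>\<close>, they are brought together
  (\<open>matching_if_frac_less\<close>); and if it equals \<open>\<gamma>\<close>, an orbit meets \<open>\<gamma>\<close>, which the prematching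
  condition excludes (\<open>frac_less_if_matching\<close>). Hence, for \<open>0 < \<gamma> < 1\<close>, the parameter \<open>\<gamma>\<close> is matching if
  and only if the fractional part of \<open>D\<^sup>n\<gamma>\<close> is less than \<open>\<gamma>\<close> for some \<open>n \<ge> 1\<close>. The two ends \<open>0\<close> and \<open>s / (s + 1)\<close> of the
  parameter range are not matching.

  Let now \<open>\<xi>\<close> be a pseudocenter and \<open>m \<ge> 1\<close> an exponent for which \<open>D\<^sup>m\<xi>\<close> is an integer. The affine map
  \<open>z \<mapsto> D\<^sup>m(z - \<xi>)\<close> vanishes at \<open>\<xi>\<close> and has a fixed point \<open>x\<close>, to the right of \<open>\<xi>\<close> for even \<open>m\<close> and to
  the left for odd \<open>m\<close>. Between \<open>\<xi>\<close> and \<open>x\<close> its values lie in \<open>[0, z)\<close>, so all points there are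
  matching (\<open>gap_segment\<close>). Take \<open>m\<close> least of its parity, that is, \<open>m\<close> is the length of \<open>w\<close> or of \<open>v\<close>.
  If \<open>x\<close> were matching as well, the matching interval would contain \<open>x\<close> together with the gap of the
  branch that makes \<open>x\<close> matching, and in it an \<open>s\<close>-adic rational whose denominator is too small; the
  one exception would force \<open>x > s / (s + 1)\<close> (\<open>fixed_point_endpoint\<close>). So the two fixed points are the boundary
  points of \<open>V\<close>.

  It remains to read off expansions. For even \<open>m\<close> the fixed point is \<open>s\<^sup>m\<xi> / (s\<^sup>m - 1)\<close>, the value of
  the periodic word with period \<open>w\<close>. For odd \<open>m\<close> it is \<open>s\<^sup>m\<xi> / (s\<^sup>m + 1)\<close>; here the period is \<open>2m\<close>, and
  its two halves are the negation of \<open>v\<close>, of value \<open>\<xi> - s\<^bsup>-m\<^esup>\<close>, and \<open>v\<close>, of value \<open>1 - \<xi>\<close>. The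
  negation of \<open>v\<close> is below \<open>w\<close> because their values differ by exactly one unit of the last place of \<open>v\<close>,
  which leaves no room for one word to be a prefix of the other. The other inequality is the
  digitwise negation of this one.
\<close>

section \<open>One-sided germs of the iterates\<close>

text \<open>On either side of \<open>\<gamma>\<close> the \<open>k\<close>-th iterate is affine near \<open>\<gamma>\<close>; the germ records its one-sided
limit and its slope. The sign \<open>\<sigma>\<close> is \<open>-1\<close> on the left of \<open>\<gamma>\<close> and \<open>1\<close> on the right. If the limit is
\<open>\<gamma>\<close> itself, the branch used next is decided by the side from which the iterate approaches it,
that is, by the sign of \<open>\<sigma>\<close> times the slope.\<close>

fun germ :: "nat \<Rightarrow> real \<Rightarrow> real \<Rightarrow> nat \<Rightarrow> real \<times> real" where
  "germ s \<gamma> \<sigma> 0 = (\<gamma>, 1)"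
| "germ s \<gamma> \<sigma> (Suc k) =
     (let (y, a) = germ s \<gamma> \<sigma> k in
      if y < \<gamma> \<or> y = \<gamma> \<and> \<sigma> * a < 0 then (y + 1, a) else (1 + real s * (1 - y), - real s * a))"

text \<open>The exponent counts how often the decreasing branch was used. It is called the level below.\<close>

lemma germ_slope_power:
  "\<exists>j. snd (germ s \<gamma> \<sigma> k) = (- real s) ^ j"
proof (induction k)
  case 0
  show ?case by (intro exI[of _ 0]) simp
next
  case (Suc k)
  then obtain j where "snd (germ s \<gamma> \<sigma> k) = (- real s) ^ j" by blast
  then have "snd (germ s \<gamma> \<sigma> (Suc k)) \<in> {(- real s) ^ j, (- real s) ^ Suc j}"
    by (auto simp: case_prod_beta Let_def)
  then show ?case by blast
qed

lemma germ_affine: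
  assumes s: "2 \<le> s" and \<sigma>: "\<sigma> = 1 \<or> \<sigma> = -1"
    and F: "F \<le> nhds \<gamma>" and side: "eventually (\<lambda>x. 0 < \<sigma> * (x - \<gamma>)) F"
  shows "eventually (\<lambda>x. (Q s \<gamma> ^^ k) x =
           fst (germ s \<gamma> \<sigma> k) + snd (germ s \<gamma> \<sigma> k) * (x - \<gamma>)) F"
proof (induction k)
  case 0
  show ?case by simp
next
  case (Suc k)
  obtain y a where g: "germ s \<gamma> \<sigma> k = (y, a)" by fastforce
  have a: "a \<noteq> 0" using germ_slope_power[of s \<gamma> \<sigma> k] g s by auto
  have lim: "((\<lambda>x. y + a * (x - \<gamma>)) \<longlongrightarrow> y) F"
  proof -
    have "((\<lambda>x. x) \<longlongrightarrow> \<gamma>) F" using F by (simp add: filterlim_def)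
    then have "((\<lambda>x. y + a * (x - \<gamma>)) \<longlongrightarrow> y + a * (\<gamma> - \<gamma>)) F" by (intro tendsto_intros)
    then show ?thesis by simp
  qed
  have sign: "eventually (\<lambda>x. (0 < a * (x - \<gamma>)) = (0 < \<sigma> * a) \<and> x \<noteq> \<gamma>) F"
    using side by eventually_elim (use \<sigma> a in \<open>auto simp: zero_less_mult_iff\<close>)
  have "eventually (\<lambda>x. y + a * (x - \<gamma>) \<le> \<gamma> \<longleftrightarrow> y < \<gamma> \<or> y = \<gamma> \<and> \<sigma> * a < 0) F"
  proof (cases y \<gamma> rule: linorder_cases)
    case less
    show ?thesis using order_tendstoD(2)[OF lim less] by eventually_elim (use less in auto)
  next
    case greater
    show ?thesis using order_tendstoD(1)[OF lim greater] by eventually_elim (use greater in auto)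
  next
    case equal
    show ?thesis using sign
    proof eventually_elim
      case (elim x)
      have "a * (x - \<gamma>) \<noteq> 0" "\<sigma> * a \<noteq> 0" using elim a \<sigma> by auto
      then have "a * (x - \<gamma>) \<le> 0 \<longleftrightarrow> \<sigma> * a < 0" using elim by linarith
      then show ?case unfolding equal by simp
    qed
  qed
  with Suc.IH show ?case
  proof eventually_elim
    case (elim x)
    have "(Q s \<gamma> ^^ Suc k) x = Q s \<gamma> (y + a * (x - \<gamma>))" using elim(1) by (simp only: funpow.simps o_apply g fst_conv snd_conv)
    also have "\<dots> = fst (germ s \<gamma> \<sigma> (Suc k)) + snd (germ s \<gamma> \<sigma> (Suc k)) * (x - \<gamma>)"
    proof (cases "y + a * (x - \<gamma>) \<le> \<gamma>")
      case True
      then have "y < \<gamma> \<or> y = \<gamma> \<and> \<sigma> * a < 0" using elim(2) by blast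
      then have "germ s \<gamma> \<sigma> (Suc k) = (y + 1, a)" by (simp only: germ.simps g Let_def prod.case if_True)
      then show ?thesis using True by (simp only: Q_def if_True fst_conv snd_conv)
    next
      case False
      then have "\<not> (y < \<gamma> \<or> y = \<gamma> \<and> \<sigma> * a < 0)" using elim(2) by blast
      then have "germ s \<gamma> \<sigma> (Suc k) = (1 + real s * (1 - y), - real s * a)"
        by (simp only: germ.simps g Let_def prod.case if_False)
      then show ?thesis using False by (simp only: Q_def if_False fst_conv snd_conv) (simp add: algebra_simps)
    qed
    finally show ?case .
  qed
qed

lemma one_sided_limits:
  assumes s: "2 \<le> s" and \<sigma>: "\<sigma> = 1 \<or> \<sigma> = -1"
    and F: "F \<le> at \<gamma>" "F \<noteq> bot" and side: "eventually (\<lambda>x. 0 < \<sigma> * (x - \<gamma>)) F"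
  shows "Lim F (Q s \<gamma> ^^ k) = fst (germ s \<gamma> \<sigma> k)"
    and "Lim F (\<lambda>x. ((Q s \<gamma> ^^ k) x - fst (germ s \<gamma> \<sigma> k)) / (x - \<gamma>)) = snd (germ s \<gamma> \<sigma> k)"
proof -
  have F': "F \<le> nhds \<gamma>" using F(1) by (simp add: at_within_def)
  note aff = germ_affine[OF s \<sigma> F' side, of k]
  have "((\<lambda>x. x) \<longlongrightarrow> \<gamma>) F" using F' by (simp add: filterlim_def)
  then have "((\<lambda>x. fst (germ s \<gamma> \<sigma> k) + snd (germ s \<gamma> \<sigma> k) * (x - \<gamma>)) \<longlongrightarrow>
      fst (germ s \<gamma> \<sigma> k) + snd (germ s \<gamma> \<sigma> k) * (\<gamma> - \<gamma>)) F" by (intro tendsto_intros)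
  moreover have "eventually (\<lambda>x. fst (germ s \<gamma> \<sigma> k) + snd (germ s \<gamma> \<sigma> k) * (x - \<gamma>) = (Q s \<gamma> ^^ k) x) F"
    using aff by eventually_elim simp
  ultimately have "((Q s \<gamma> ^^ k) \<longlongrightarrow> fst (germ s \<gamma> \<sigma> k)) F"
    using tendsto_cong by fastforce
  then show "Lim F (Q s \<gamma> ^^ k) = fst (germ s \<gamma> \<sigma> k)" by (rule tendsto_Lim[OF F(2)])
  have "eventually (\<lambda>x. ((Q s \<gamma> ^^ k) x - fst (germ s \<gamma> \<sigma> k)) / (x - \<gamma>) = snd (germ s \<gamma> \<sigma> k)) F"
    using aff side by eventually_elim auto
  then show "Lim F (\<lambda>x. ((Q s \<gamma> ^^ k) x - fst (germ s \<gamma> \<sigma> k)) / (x - \<gamma>)) = snd (germ s \<gamma> \<sigma> k)"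
    by (intro tendsto_Lim[OF F(2)] tendsto_eventually)
qed

lemma left_limits:
  assumes "2 \<le> s"
  shows "Q_left s \<gamma> k = fst (germ s \<gamma> (-1) k)" and "dQ_left s \<gamma> k = snd (germ s \<gamma> (-1) k)"
proof -
  have *: "eventually (\<lambda>x. 0 < (-1) * (x - \<gamma>)) (at_left \<gamma>)"
    by (auto simp: eventually_at_filter)
  have **: "at_left \<gamma> \<le> at \<gamma>" "at_left \<gamma> \<noteq> bot" by (auto simp: at_le)
  note lims = one_sided_limits[where \<sigma> = "-1", OF assms _ ** *]
  show 1: "Q_left s \<gamma> k = fst (germ s \<gamma> (-1) k)" using lims(1) by (simp add: Q_left_def)
  show "dQ_left s \<gamma> k = snd (germ s \<gamma> (-1) k)" using lims(2) by (simp add: dQ_left_def 1)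
qed

lemma right_limits:
  assumes "2 \<le> s"
  shows "Q_right s \<gamma> k = fst (germ s \<gamma> 1 k)" and "dQ_right s \<gamma> k = snd (germ s \<gamma> 1 k)"
proof -
  have *: "eventually (\<lambda>x. 0 < 1 * (x - \<gamma>)) (at_right \<gamma>)"
    by (auto simp: eventually_at_filter)
  have **: "at_right \<gamma> \<le> at \<gamma>" "at_right \<gamma> \<noteq> bot" by (auto simp: at_le)
  note lims = one_sided_limits[where \<sigma> = 1, OF assms _ ** *]
  show 1: "Q_right s \<gamma> k = fst (germ s \<gamma> 1 k)" using lims(1) by (simp add: Q_right_def)
  show "dQ_right s \<gamma> k = snd (germ s \<gamma> 1 k)" using lims(2) by (simp add: dQ_right_def 1)
qed

lemma matching_set_germ:
  assumes "2 \<le> s"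
  shows "\<gamma> \<in> matching_set s \<longleftrightarrow> (\<exists>l r. 1 \<le> l \<and> 1 \<le> r \<and> germ s \<gamma> (-1) l = germ s \<gamma> 1 r \<and>
     (\<forall>i. 1 \<le> i \<and> i < l \<longrightarrow> fst (germ s \<gamma> (-1) i) \<noteq> \<gamma>) \<and>
     (\<forall>i. 1 \<le> i \<and> i < r \<longrightarrow> fst (germ s \<gamma> 1 i) \<noteq> \<gamma>))"
proof -
  have *: "\<gamma> \<notin> prematching_set s \<gamma> l r \<longleftrightarrow>
     (\<forall>i. 1 \<le> i \<and> i < l \<longrightarrow> fst (germ s \<gamma> (-1) i) \<noteq> \<gamma>) \<and>
     (\<forall>i. 1 \<le> i \<and> i < r \<longrightarrow> fst (germ s \<gamma> 1 i) \<noteq> \<gamma>)" for l r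
  proof -
    have "1 \<le> i \<and> i \<le> n - 1 \<longleftrightarrow> 1 \<le> i \<and> i < n" for i n :: nat by auto
    then show ?thesis
      unfolding prematching_set_def left_limits[OF assms] right_limits[OF assms] by auto
  qed
  show ?thesis
    unfolding matching_set_def mem_Collect_eq * matching_condition_def left_limits[OF assms]
      right_limits[OF assms] prod_eq_iff by (simp only: conj_assoc)
qed

lemma germ_slope_mono:
  assumes "1 \<le> s" "i \<le> k"
  shows "\<bar>snd (germ s \<gamma> \<sigma> i)\<bar> \<le> \<bar>snd (germ s \<gamma> \<sigma> k)\<bar>"
  using assms(2)
proof (induction k rule: dec_induct)
  case (step k)
  have "\<bar>snd (germ s \<gamma> \<sigma> k)\<bar> \<le> \<bar>snd (germ s \<gamma> \<sigma> (Suc k))\<bar>"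
    using assms(1) by (auto simp: case_prod_beta Let_def abs_mult mult_le_cancel_right1)
  with step show ?case by linarith
qed simp

lemma germ_climb:
  assumes "germ s \<gamma> \<sigma> k = (y, a)" and "\<And>r. r < t \<Longrightarrow> y + real r < \<gamma>" and "r \<le> t"
  shows "germ s \<gamma> \<sigma> (k + r) = (y + real r, a)"
  using assms(3)
proof (induction r)
  case (Suc r)
  then show ?case using assms(2)[of r] by simp
qed (use assms in simp)

text \<open>The orbit reaches level \<open>j\<close> for the first time at step \<open>k\<close>, with value \<open>y\<close>, and has not met \<open>\<gamma>\<close>
after its start. The last clause is what membership in the prematching set is about.\<close>

definition enters :: "nat \<Rightarrow> real \<Rightarrow> real \<Rightarrow> nat \<Rightarrow> nat \<Rightarrow> real \<Rightarrow> bool" where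
  "enters s \<gamma> \<sigma> j k y \<longleftrightarrow> 1 \<le> k \<and> germ s \<gamma> \<sigma> k = (y, (- real s) ^ j) \<and>
     (\<forall>i<k. \<bar>snd (germ s \<gamma> \<sigma> i)\<bar> < real s ^ j) \<and>
     (\<forall>i. 1 \<le> i \<and> i < k \<longrightarrow> fst (germ s \<gamma> \<sigma> i) \<noteq> \<gamma>)"

lemma enters_climb:
  assumes "enters s \<gamma> \<sigma> j k y" "\<And>r. r < t \<Longrightarrow> y + real r < \<gamma>" "r \<le> t"
  shows "germ s \<gamma> \<sigma> (k + r) = (y + real r, (- real s) ^ j)"
  by (rule germ_climb[OF _ assms(2,3)]) (use assms(1) in \<open>auto simp: enters_def\<close>)

lemma enters_avoid:
  assumes e: "enters s \<gamma> \<sigma> j k y" and below: "\<And>r. r < t \<Longrightarrow> y + real r < \<gamma>"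
    and i: "1 \<le> i" "i < k + t"
  shows "fst (germ s \<gamma> \<sigma> i) \<noteq> \<gamma>"
proof (cases "i < k")
  case True
  then show ?thesis using e i by (auto simp: enters_def)
next
  case False
  then obtain r where r: "i = k + r" "r < t" using i by (auto simp: le_iff_add not_less)
  then show ?thesis using enters_climb[OF e below, of t r] below[of r] by auto
qed

text \<open>The life of an orbit on one level: it climbs in unit steps until it exceeds \<open>\<gamma>\<close>, and then the
decreasing branch takes it to the next level.\<close>

lemma enters_Suc:
  assumes s: "2 \<le> s" and e: "enters s \<gamma> \<sigma> j k y"
    and below: "\<And>r. r < t \<Longrightarrow> y + real r < \<gamma>" and above: "\<gamma> < y + real t"
  shows "enters s \<gamma> \<sigma> (Suc j) (k + t + 1) (1 + real s * (1 - (y + real t)))"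
proof -
  have g: "germ s \<gamma> \<sigma> (k + t) = (y + real t, (- real s) ^ j)"
    using enters_climb[OF e below, of t t] by simp
  then have g': "germ s \<gamma> \<sigma> (k + t + 1) = (1 + real s * (1 - (y + real t)), (- real s) ^ Suc j)"
    using above by simp
  have level: "\<bar>snd (germ s \<gamma> \<sigma> i)\<bar> < real s ^ Suc j" if "i < k + t + 1" for i
  proof -
    have "\<bar>snd (germ s \<gamma> \<sigma> i)\<bar> \<le> \<bar>snd (germ s \<gamma> \<sigma> (k + t))\<bar>"
      using germ_slope_mono s that by auto
    also have "\<dots> = real s ^ j" using g by (simp add: power_abs)
    also have "\<dots> < real s ^ Suc j" using s by simp
    finally show ?thesis .
  qed
  have "fst (germ s \<gamma> \<sigma> i) \<noteq> \<gamma>" if "1 \<le> i" "i < k + t + 1" for i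
  proof (cases "i = k + t")
    case True
    then show ?thesis using g above by simp
  next
    case False
    then show ?thesis using enters_avoid[OF e below, of t i] that by simp
  qed
  then show ?thesis using g' level by (auto simp: enters_def)
qed

section \<open>An arithmetic criterion for matching\<close>

text \<open>The two one-sided orbits interchange their roles at each level, so \<open>\<sigma>\<close> is the side whose orbit is
the upper one, entering the level at \<open>U\<close>, while the other one enters at \<open>y\<close>. Both entry values are
congruent to \<open>(-s)\<^sup>j\<gamma>\<close> modulo \<open>1\<close>.\<close>

definition separated :: "nat \<Rightarrow> real \<Rightarrow> nat \<Rightarrow> bool" where
  "separated s \<gamma> j \<longleftrightarrow> (\<exists>\<sigma> kU kL U y. (\<sigma> = 1 \<or> \<sigma> = -1) \<and>
     enters s \<gamma> \<sigma> j kU U \<and> enters s \<gamma> (-\<sigma>) j kL y \<and>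
     1 < U \<and> y \<le> 1 - real s * \<gamma> \<and> U - (- real s) ^ j * \<gamma> \<in> \<int> \<and> U - y \<in> \<int>)"

lemma separated_1:
  assumes s: "2 \<le> s" and \<gamma>: "0 < \<gamma>" "\<gamma> < 1"
  shows "separated s \<gamma> 1"
proof -
  have R: "enters s \<gamma> 1 1 1 (1 + real s * (1 - \<gamma>))"
    using s by (auto simp: enters_def)
  have "germ s \<gamma> (-1) (Suc 0) = (\<gamma> + 1, 1)" by simp
  then have "enters s \<gamma> (-1) 1 2 (1 - real s * \<gamma>)"
    using s by (auto simp: enters_def numeral_2_eq_2 less_Suc_eq algebra_simps)
  with R show ?thesis using s \<gamma> unfolding separated_def
    by (intro exI[of _ 1] exI[of _ "1::real"] exI[of _ "2::nat"] exI[of _ "1 + real s * (1 - \<gamma>)"]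
        exI[of _ "1 - real s * \<gamma>"]) (auto simp: algebra_simps)
qed

text \<open>The bounds on the entry values become exact positions relative to the fractional part of
\<open>(-s)\<^sup>j\<gamma>\<close>: the lower orbit enters at most at that fractional part, because it enters below \<open>1\<close>,
and the upper orbit enters above it by a positive integer.\<close>

lemma separated_lower:
  assumes s: "2 \<le> s" and \<gamma>: "0 < \<gamma>" "\<gamma> < 1" and sep: "separated s \<gamma> j"
  obtains \<sigma> kU kL U t d where "\<sigma> = 1 \<or> \<sigma> = -1" "enters s \<gamma> \<sigma> j kU U"
    "enters s \<gamma> (-\<sigma>) j kL (frac ((- real s) ^ j * \<gamma>) - real t)"
    "U = 1 + frac ((- real s) ^ j * \<gamma>) + real d" "1 < U"
proof -
  define f where "f = frac ((- real s) ^ j * \<gamma>)"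
  have f: "0 \<le> f" "f < 1" by (auto simp: f_def frac_lt_1)
  obtain \<sigma> kU kL U y where e: "\<sigma> = 1 \<or> \<sigma> = -1" "enters s \<gamma> \<sigma> j kU U" "enters s \<gamma> (-\<sigma>) j kL y"
     and U: "1 < U" and y: "y \<le> 1 - real s * \<gamma>"
     and int: "U - (- real s) ^ j * \<gamma> \<in> \<int>" "U - y \<in> \<int>"
    using sep unfolding separated_def by blast
  have "(- real s) ^ j * \<gamma> - f \<in> \<int>" by (simp add: f_def frac_def)
  then have "U - f \<in> \<int>" using int(1) Ints_add by fastforce
  then obtain p where p: "U - f = of_int p" by (auto elim: Ints_cases)
  have "f - y \<in> \<int>" using \<open>U - f \<in> \<int>\<close> int(2) Ints_diff by fastforce
  then obtain q where q: "f - y = of_int q" by (auto elim: Ints_cases)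
  have "0 < real s * \<gamma>" using s \<gamma> by simp
  then have "real_of_int q > -1" using q f y by linarith
  then have "q \<ge> 0" by linarith
  moreover have "real_of_int p > 0" using p f U by linarith
  then have "p \<ge> 1" by linarith
  ultimately have "y = f - real (nat q)" "U = 1 + f + real (nat (p - 1))" using p q by auto
  then show ?thesis using that e U by (simp add: f_def)
qed

text \<open>If the fractional part \<open>f\<close> of \<open>(-s)\<^sup>j\<gamma>\<close> exceeds \<open>\<gamma>\<close>, the lower orbit climbs exactly to \<open>f\<close> and leaves the
level there. The upper orbit leaves at once from its entry value, which is at least \<open>1 + f\<close>. As the
branch is decreasing, the orbit that was lower is the upper one on the next level.\<close>

lemma separated_Suc:
  assumes s: "2 \<le> s" and \<gamma>: "0 < \<gamma>" "\<gamma> < 1" and sep: "separated s \<gamma> j"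
    and big: "\<gamma> < frac ((- real s) ^ j * \<gamma>)"
  shows "separated s \<gamma> (Suc j)"
proof -
  define f where "f = frac ((- real s) ^ j * \<gamma>)"
  have f: "0 \<le> f" "f < 1" "\<gamma> < f" using big by (auto simp: f_def frac_lt_1)
  obtain \<sigma> kU kL U t d where e: "\<sigma> = 1 \<or> \<sigma> = -1" "enters s \<gamma> \<sigma> j kU U" "enters s \<gamma> (-\<sigma>) j kL (f - real t)"
     and U: "U = 1 + f + real d" "1 < U"
    by (rule separated_lower[OF s \<gamma> sep, folded f_def])
  have low: "enters s \<gamma> \<sigma> (Suc j) (kU + 0 + 1) (1 + real s * (1 - (U + real 0)))"
    by (rule enters_Suc[OF s e(2)]) (use U \<gamma> in auto)
  have up: "enters s \<gamma> (-\<sigma>) (Suc j) (kL + t + 1) (1 + real s * (1 - (f - real t + real t)))"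
    by (rule enters_Suc[OF s e(3)]) (use f \<gamma> in auto)
  let ?U = "1 + real s * (1 - f)"
  have "1 < ?U" using f s by simp
  moreover have "1 + real s * (1 - U) \<le> 1 - real s * \<gamma>"
  proof -
    have "real s * (1 + \<gamma>) \<le> real s * U" using U f by (intro mult_left_mono) auto
    then show ?thesis by (simp add: algebra_simps)
  qed
  moreover have "?U - (- real s) ^ Suc j * \<gamma> \<in> \<int>"
  proof -
    have "?U - (- real s) ^ Suc j * \<gamma> = 1 + real s * (1 + of_int \<lfloor>(- real s) ^ j * \<gamma>\<rfloor>)"
      by (simp add: f_def frac_def algebra_simps)
    also have "\<dots> \<in> \<int>" by (intro Ints_add Ints_mult) auto
    finally show ?thesis .
  qed
  moreover have "?U - (1 + real s * (1 - U)) \<in> \<int>"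
  proof -
    have "?U - (1 + real s * (1 - U)) = real s * (1 + real d)" using U by (simp add: algebra_simps)
    then show ?thesis by simp
  qed
  moreover have "enters s \<gamma> (-(-\<sigma>)) (Suc j) (kU + 0 + 1) (1 + real s * (1 - U))"
    using low by (simp only: minus_minus of_nat_0 add_0_right)
  moreover have "enters s \<gamma> (-\<sigma>) (Suc j) (kL + t + 1) ?U" using up by (simp only: diff_add_cancel)
  moreover have "-\<sigma> = 1 \<or> -\<sigma> = -1" using e(1) by auto
  ultimately show ?thesis unfolding separated_def by (intro exI conjI)
qed

lemma separated_upto:
  assumes s: "2 \<le> s" and \<gamma>: "0 < \<gamma>" "\<gamma> < 1" and j: "1 \<le> j"
    and big: "\<And>i. 1 \<le> i \<Longrightarrow> i < j \<Longrightarrow> \<gamma> < frac ((- real s) ^ i * \<gamma>)"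
  shows "separated s \<gamma> j"
  using j big
proof (induction j rule: dec_induct)
  case base
  show ?case by (rule separated_1[OF s \<gamma>])
next
  case (step j)
  then show ?case using separated_Suc[OF s \<gamma>, of j] by simp
qed



lemma frac_of_int_diff_eq:
  assumes "x - y \<in> \<int>"
  shows "frac x = frac (y :: real)"
proof -
  obtain n where "x - y = of_int n" using assms by (auto elim: Ints_cases)
  then have "x = y + of_int n" by simp
  then show ?thesis by (simp add: frac_def)
qed

text \<open>Up to the first level \<open>N\<close> where the fractional part \<open>f\<close> of \<open>(-s)\<^sup>N\<gamma>\<close> falls below \<open>\<gamma>\<close>, the two orbits
stay separated. On level \<open>N\<close> the lower orbit climbs past \<open>\<gamma>\<close> to \<open>1 + f\<close>, and so enters the next level
at \<open>1 - s f \<le> 1\<close>. The other orbit enters that level below this value by a nonnegative multiple of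
\<open>s\<close>, and climbs up to it using only points below \<open>\<gamma>\<close>. The orbits therefore meet, with equal slopes.\<close>

lemma matching_if_frac_less:
  assumes s: "2 \<le> s" and \<gamma>: "0 < \<gamma>" "\<gamma> < 1"
    and n: "1 \<le> n" "frac ((- real s) ^ n * \<gamma>) < \<gamma>"
  shows "\<gamma> \<in> matching_set s"
proof -
  define N where "N = (LEAST n. 1 \<le> n \<and> frac ((- real s) ^ n * \<gamma>) < \<gamma>)"
  have N: "1 \<le> N" "frac ((- real s) ^ N * \<gamma>) < \<gamma>"
    using LeastI[of "\<lambda>n. 1 \<le> n \<and> frac ((- real s) ^ n * \<gamma>) < \<gamma>" n] n by (auto simp: N_def)
  have least: "N \<le> i" if "1 \<le> i" "frac ((- real s) ^ i * \<gamma>) < \<gamma>" for i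
    unfolding N_def by (rule Least_le) (use that in auto)
  have "\<gamma> < frac ((- real s) ^ i * \<gamma>)" if i: "1 \<le> i" "i < N" for i
  proof (rule ccontr)
    assume "\<not> \<gamma> < frac ((- real s) ^ i * \<gamma>)"
    then have "frac ((- real s) ^ i * \<gamma>) = \<gamma>" using least[of i] i by force
    then have "(- real s) ^ i * \<gamma> - \<gamma> \<in> \<int>" using frac_def[of "(- real s) ^ i * \<gamma>"]
      by (metis Ints_of_int add_diff_cancel_left' diff_add_cancel)
    then have "(- real s) ^ (N - i) * ((- real s) ^ i * \<gamma> - \<gamma>) \<in> \<int>" by (intro Ints_mult Ints_power) auto
    moreover have "(- real s) ^ (N - i) * ((- real s) ^ i * \<gamma> - \<gamma>) =
        (- real s) ^ N * \<gamma> - (- real s) ^ (N - i) * \<gamma>"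
      using i by (simp add: right_diff_distrib flip: power_add mult.assoc)
    ultimately have "frac ((- real s) ^ N * \<gamma>) = frac ((- real s) ^ (N - i) * \<gamma>)"
      by (intro frac_of_int_diff_eq) simp
    then have "N \<le> N - i" using N i by (intro least) auto
    then show False using i by simp
  qed
  then have sep: "separated s \<gamma> N" using separated_upto[OF s \<gamma>] N by blast
  define f where "f = frac ((- real s) ^ N * \<gamma>)"
  have f: "0 \<le> f" "f < 1" "f < \<gamma>" using N by (auto simp: f_def frac_lt_1)
  obtain \<sigma> kU kL U t d where \<sigma>: "\<sigma> = 1 \<or> \<sigma> = -1"
     and e: "enters s \<gamma> \<sigma> N kU U" "enters s \<gamma> (-\<sigma>) N kL (f - real t)"
     and U: "U = 1 + f + real d" "1 < U"
    by (rule separated_lower[OF s \<gamma> sep, folded f_def])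
  \<comment> \<open>One step more than to \<open>f\<close>, because \<open>f < \<gamma>\<close>: the lower orbit leaves the level from \<open>1 + f\<close>.\<close>
  have up: "enters s \<gamma> (-\<sigma>) (Suc N) (kL + (t + 1) + 1) (1 + real s * (1 - (f - real t + real (t + 1))))"
    by (rule enters_Suc[OF s e(2)]) (use f \<gamma> in auto)
  have low: "enters s \<gamma> \<sigma> (Suc N) (kU + 0 + 1) (1 + real s * (1 - (U + real 0)))"
    by (rule enters_Suc[OF s e(1)]) (use U \<gamma> in auto)
  define l where "l = kU + 0 + 1 + s * d"
  define u where "u = kL + (t + 1) + 1"
  have below: "1 + real s * (1 - (U + real 0)) + real r < \<gamma>" if "r < s * d" for r
  proof -
    have "real s * f \<ge> 0" using f by simp
    moreover have "real r + 1 \<le> real s * real d"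
      proof -
      have "r + 1 \<le> s * d" using that by simp
      then have "real (r + 1) \<le> real (s * d)" by (simp only: of_nat_le_iff)
      then show ?thesis by simp
    qed
    ultimately show ?thesis using \<gamma> U by (simp add: algebra_simps)
  qed
  have "germ s \<gamma> \<sigma> l = (1 - real s * f, (- real s) ^ Suc N)"
    using enters_climb[OF low below, of "s * d" "s * d"] U
    by (simp add: l_def algebra_simps del: germ.simps)
  moreover have "germ s \<gamma> (-\<sigma>) u = (1 - real s * f, (- real s) ^ Suc N)"
    using up by (simp add: enters_def u_def del: germ.simps)
  ultimately have "germ s \<gamma> \<sigma> l = germ s \<gamma> (-\<sigma>) u" by simp
  moreover have "\<forall>i. 1 \<le> i \<and> i < l \<longrightarrow> fst (germ s \<gamma> \<sigma> i) \<noteq> \<gamma>"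
    using enters_avoid[OF low below] unfolding l_def by blast
  moreover have "\<forall>i. 1 \<le> i \<and> i < u \<longrightarrow> fst (germ s \<gamma> (-\<sigma>) i) \<noteq> \<gamma>"
    using up unfolding enters_def u_def by blast
  moreover have "1 \<le> l" "1 \<le> u" by (auto simp: l_def u_def)
  ultimately show ?thesis unfolding matching_set_germ[OF s] using \<sigma>
    by (elim disjE; intro exI[of _ "if \<sigma> = 1 then u else l"] exI[of _ "if \<sigma> = 1 then l else u"]) auto
qed


text \<open>Equal slopes force matching orbits to meet on a common level \<open>J\<close>. If no fractional part falls below
\<open>\<gamma>\<close>, the orbits are separated on every level until a fractional part equals \<open>\<gamma>\<close>. On a separated level
they cannot meet, since the lower orbit stays below \<open>1\<close> and the upper one has the single value
\<open>U > 1\<close>. If a fractional part equals \<open>\<gamma>\<close>, the lower orbit runs into \<open>\<gamma>\<close> itself, so any later meeting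
is excluded by the prematching set.\<close>

lemma frac_less_if_matching:
  assumes s: "2 \<le> s" and \<gamma>: "0 < \<gamma>" "\<gamma> < 1" and match: "\<gamma> \<in> matching_set s"
  shows "\<exists>n\<ge>1. frac ((- real s) ^ n * \<gamma>) < \<gamma>"
proof (rule ccontr)
  assume "\<not> ?thesis"
  then have big: "\<gamma> \<le> frac ((- real s) ^ n * \<gamma>)" if "1 \<le> n" for n
    using that by force
  obtain l r where lr: "1 \<le> l" "1 \<le> r" "germ s \<gamma> (-1) l = germ s \<gamma> 1 r"
     "\<And>i. 1 \<le> i \<Longrightarrow> i < l \<Longrightarrow> fst (germ s \<gamma> (-1) i) \<noteq> \<gamma>"
     "\<And>i. 1 \<le> i \<Longrightarrow> i < r \<Longrightarrow> fst (germ s \<gamma> 1 i) \<noteq> \<gamma>"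
    using match unfolding matching_set_germ[OF s] by blast
  define \<kappa> where "\<kappa> = (\<lambda>\<sigma>::real. if \<sigma> = 1 then r else l)"
  have \<kappa>: "germ s \<gamma> \<sigma> (\<kappa> \<sigma>) = germ s \<gamma> (-\<sigma>) (\<kappa> (-\<sigma>))"
    "1 \<le> i \<Longrightarrow> i < \<kappa> \<sigma> \<Longrightarrow> fst (germ s \<gamma> \<sigma> i) \<noteq> \<gamma>" if "\<sigma> = 1 \<or> \<sigma> = -1" for \<sigma> i
    using that lr by (auto simp: \<kappa>_def)
  obtain J where J: "snd (germ s \<gamma> 1 r) = (- real s) ^ J" using germ_slope_power by blast
  have slope: "snd (germ s \<gamma> \<sigma> (\<kappa> \<sigma>)) = (- real s) ^ J" if "\<sigma> = 1 \<or> \<sigma> = -1" for \<sigma>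
    using that J lr(3) by (auto simp: \<kappa>_def)
  have "J \<noteq> 0"
  proof
    assume "J = 0"
    then have "\<bar>snd (germ s \<gamma> 1 1)\<bar> \<le> 1" using germ_slope_mono[of s 1 r \<gamma> 1] lr(2) J s by simp
    then show False using s by simp
  qed
  then have J1: "1 \<le> J" by simp
  \<comment> \<open>The first level on which the orbits meet or the lower orbit runs into \<open>\<gamma>\<close>.\<close>
  define P where "P = (\<lambda>j. 1 \<le> j \<and> (j = J \<or> frac ((- real s) ^ j * \<gamma>) = \<gamma>))"
  define j where "j = (LEAST j. P j)"
  have "P J" using J1 by (simp add: P_def)
  then have Pj: "P j" and jJ: "j \<le> J" unfolding j_def by (auto intro: LeastI Least_le)
  have "\<gamma> < frac ((- real s) ^ i * \<gamma>)" if i: "1 \<le> i" "i < j" for i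
    using not_less_Least[of i P] i big[of i] Pj
    by (auto simp: P_def j_def order.strict_iff_order)
  then have sep: "separated s \<gamma> j" using separated_upto[OF s \<gamma>] Pj by (simp add: P_def)
  define f where "f = frac ((- real s) ^ j * \<gamma>)"
  have f: "0 \<le> f" "f < 1" "\<gamma> \<le> f" using big[of j] Pj by (auto simp: f_def frac_lt_1 P_def)
  obtain \<sigma> kU kL U t d where \<sigma>: "\<sigma> = 1 \<or> \<sigma> = -1"
     and e: "enters s \<gamma> \<sigma> j kU U" "enters s \<gamma> (-\<sigma>) j kL (f - real t)"
     and U: "U = 1 + f + real d" "1 < U"
    by (rule separated_lower[OF s \<gamma> sep, folded f_def])
  have \<sigma>': "-\<sigma> = 1 \<or> -\<sigma> = -1" using \<sigma> by auto
  have below: "f - real t + real r < \<gamma>" if "r < t" for r using that f \<gamma> by auto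
  have slope_less: "k < k'" if "\<bar>snd (germ s \<gamma> \<tau> k)\<bar> < \<bar>snd (germ s \<gamma> \<tau> k')\<bar>" for \<tau> k k'
    using germ_slope_mono[of s k' k \<gamma> \<tau>] s that by force
  have pow: "\<bar>(- real s) ^ i\<bar> = real s ^ i" for i by (simp add: power_abs)
  have end_L: "\<kappa> (-\<sigma>) \<le> kL + t"
  proof (cases "f = \<gamma>")
    case True
    then have "fst (germ s \<gamma> (-\<sigma>) (kL + t)) = \<gamma>" using enters_climb[OF e(2) below, of t t] by simp
    moreover have "1 \<le> kL" using e by (simp add: enters_def)
    ultimately show ?thesis using \<kappa>(2)[OF \<sigma>', of "kL + t"] by force
  next
    case False
    then have "j = J" using Pj by (simp add: P_def f_def)
    have "enters s \<gamma> (-\<sigma>) (Suc j) (kL + t + 1) (1 + real s * (1 - (f - real t + real t)))"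
      by (rule enters_Suc[OF s e(2) below]) (use f False in auto)
    then have "\<kappa> (-\<sigma>) < kL + t + 1"
      using s by (intro slope_less[of "-\<sigma>"]) (auto simp: slope[OF \<sigma>'] enters_def \<open>j = J\<close> power_abs abs_mult simp del: germ.simps)
    then show ?thesis by simp
  qed
  have "real s ^ J \<le> real s ^ j"
    using germ_slope_mono[of s "\<kappa> (-\<sigma>)" "kL + t" \<gamma> "-\<sigma>"] end_L s slope[OF \<sigma>']
      enters_climb[OF e(2) below, of t t] by (simp add: pow)
  then have "J = j" using jJ s by simp
  have "\<kappa> (-\<sigma>) \<ge> kL" "\<kappa> \<sigma> \<ge> kU"
    using e slope[OF \<sigma>'] slope[OF \<sigma>] pow unfolding enters_def \<open>J = j\<close>
    by (auto simp: not_less[symmetric])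
  have "enters s \<gamma> \<sigma> (Suc j) (kU + 0 + 1) (1 + real s * (1 - (U + real 0)))"
    by (rule enters_Suc[OF s e(1)]) (use U \<gamma> in auto)
  then have "\<kappa> \<sigma> < kU + 0 + 1"
    using s by (intro slope_less[of \<sigma>]) (auto simp: slope[OF \<sigma>] enters_def \<open>J = j\<close> power_abs abs_mult simp del: germ.simps)
  then have "\<kappa> \<sigma> = kU" using \<open>\<kappa> \<sigma> \<ge> kU\<close> by simp
  then have "fst (germ s \<gamma> \<sigma> (\<kappa> \<sigma>)) = U" using e by (simp add: enters_def)
  moreover obtain q where "\<kappa> (-\<sigma>) = kL + q" "q \<le> t"
    using \<open>\<kappa> (-\<sigma>) \<ge> kL\<close> end_L by (auto simp: le_iff_add)
  then have "fst (germ s \<gamma> (-\<sigma>) (\<kappa> (-\<sigma>))) < 1"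
    using enters_climb[OF e(2) below, of t q] f by simp
  ultimately show False using \<kappa>(1)[OF \<sigma>] U by simp
qed


text \<open>At \<open>\<gamma> = 0\<close> the left orbit stays at \<open>1\<close> from its first step on, and the right orbit climbs from \<open>1 - s\<^sup>2\<close> to \<open>\<gamma>\<close> before
it could reach \<open>1\<close>. The criterion above needs \<open>0 < \<gamma>\<close>, because for \<open>\<gamma> = 0\<close> the lower orbit enters
level \<open>1\<close> at \<open>1\<close> rather than below it.\<close>

lemma zero_not_matching:
  assumes s: "2 \<le> s"
  shows "0 \<notin> matching_set s"
proof
  assume "0 \<in> matching_set s"
  then obtain l r where lr: "1 \<le> l" "1 \<le> r" "germ s 0 (-1) l = germ s 0 1 r"
     "\<And>i. 1 \<le> i \<Longrightarrow> i < r \<Longrightarrow> fst (germ s 0 1 i) \<noteq> 0"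
    unfolding matching_set_germ[OF s] by blast
  have "fst (germ s 0 (-1) l) = 1" using lr(1)
    by (induction l rule: dec_induct) (auto simp: case_prod_beta Let_def)
  then have r1: "fst (germ s 0 1 r) = 1" using lr(3) by simp
  have g1: "germ s 0 1 (Suc 0) = (1 + real s, - real s)" by simp
  then have g2: "germ s 0 1 2 = (1 - real s ^ 2, real s ^ 2)"
    using s by (simp add: numeral_2_eq_2 power2_eq_square)
  have below: "1 - real s ^ 2 + real i < 0" if "i < s\<^sup>2 - 1" for i
  proof -
    have "i + 1 < s\<^sup>2" using that by simp
    then have "real (i + 1) < real (s\<^sup>2)" by (simp only: of_nat_less_iff)
    then show ?thesis by simp
  qed
  note climb = germ_climb[OF g2 below, of "s\<^sup>2 - 1"]
  have s2: "s\<^sup>2 \<ge> 1" using s by simp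
  have "r \<noteq> 1" using r1 s by auto
  then have "2 \<le> r" using lr by simp
  then obtain q where q: "r = 2 + q" using le_Suc_ex by blast
  show False
  proof (cases "q \<le> s\<^sup>2 - 1")
    case True
    then have "1 - real (s ^ 2) + real q = 1" using climb[of q] q r1 by simp
    then have "q = s ^ 2" by linarith
    then show False using True s2 by simp
  next
    case False
    then have "fst (germ s 0 1 (2 + (s\<^sup>2 - 1))) \<noteq> 0" using q by (intro lr(4)) auto
    then show False using climb[of "s\<^sup>2 - 1"] s2 by (simp add: of_nat_diff)
  qed
qed



section \<open>Gaps around \<open>s\<close>-adic rationals\<close>

lemma neg_power_cases:
  assumes "2 \<le> s" "1 \<le> n"
  shows "2 \<le> real s ^ n"
    and "(- real s) ^ n = (if even n then real s ^ n else - (real s ^ n))"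
proof -
  have "2 \<le> real s ^ 1" using assms by simp
  also have "\<dots> \<le> real s ^ n" using assms by (intro power_increasing) auto
  finally show "2 \<le> real s ^ n" .
qed simp

text \<open>The branch \<open>z \<mapsto> (-s)\<^sup>n z - k\<close> has slope greater than \<open>1\<close> or negative. Starting at its zero \<open>\<eta>\<close> and
moving in the direction in which it increases, its graph stays between \<open>0\<close> and the diagonal until
it meets the diagonal, so all points passed on the way satisfy the matching criterion. This lemma
serves twice: \<open>x\<close> is the fixed point of the branch, or \<open>x\<close> is a point where the criterion holds
through this branch.\<close>

lemma gap_segment:
  assumes s: "2 \<le> s" "1 \<le> n"
    and \<eta>: "(- real s) ^ n * \<eta> = of_int k"
    and x: "0 \<le> (- real s) ^ n * x - of_int k" "(- real s) ^ n * x - of_int k \<le> x"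
    and z: "z \<in> closed_segment \<eta> x" "z \<noteq> x \<or> (- real s) ^ n * x - of_int k < x"
  shows "0 \<le> (- real s) ^ n * z - of_int k" "(- real s) ^ n * z - of_int k < z"
proof -
  define a where "a = (- real s) ^ n"
  have a: "a > 1 \<or> a < 0" using neg_power_cases[OF s] s by (simp add: a_def)
  have k: "real_of_int k = a * \<eta>" using \<eta> by (simp add: a_def)
  have 0: "0 \<le> a * (x - \<eta>)" using x(1) unfolding a_def[symmetric] k by (simp add: algebra_simps)
  have "0 \<le> a * (z - \<eta>) \<and> 0 \<le> (1 - a) * (z - x) \<and> (z \<noteq> x \<longrightarrow> 0 < (1 - a) * (z - x))"
  proof (cases "a > 1")
    case True
    then have "\<eta> \<le> x" using 0 by (simp add: zero_le_mult_iff)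
    then have "\<eta> \<le> z" "z \<le> x" using z(1) by (auto simp: closed_segment_eq_real_ivl)
    then show ?thesis using True by (auto intro: mult_nonneg_nonneg mult_nonpos_nonpos mult_neg_neg)
  next
    case False
    then have "a < 0" using a by simp
    then have "x \<le> \<eta>" using 0 by (simp add: zero_le_mult_iff)
    then have "z \<le> \<eta>" "x \<le> z" using z(1) by (auto simp: closed_segment_eq_real_ivl split: if_splits)
    then show ?thesis using \<open>a < 0\<close> by (auto intro: mult_nonneg_nonneg mult_nonpos_nonpos mult_pos_pos)
  qed
  then have *: "0 \<le> a * (z - \<eta>)" "0 \<le> (1 - a) * (z - x)" "z \<noteq> x \<Longrightarrow> 0 < (1 - a) * (z - x)" by auto
  show "0 \<le> (- real s) ^ n * z - of_int k"
    using *(1) unfolding a_def[symmetric] k by (simp add: algebra_simps)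
  have "z - (a * z - a * \<eta>) = (x - (a * x - a * \<eta>)) + (1 - a) * (z - x)" by (simp add: algebra_simps)
  moreover have "0 < (x - (a * x - a * \<eta>)) + (1 - a) * (z - x)"
    using * x(2) z(2) unfolding a_def[symmetric] k by (cases "z = x") (auto intro: add_nonneg_pos)
  ultimately have "0 < z - (a * z - a * \<eta>)" by simp
  then show "(- real s) ^ n * z - of_int k < z" unfolding a_def[symmetric] k by simp
qed

lemma gap_frac_less:
  assumes "2 \<le> s" "1 \<le> n" "(- real s) ^ n * \<eta> = of_int k"
    and "0 \<le> (- real s) ^ n * x - of_int k" "(- real s) ^ n * x - of_int k \<le> x"
    and "z \<in> closed_segment \<eta> x" "z \<noteq> x \<or> (- real s) ^ n * x - of_int k < x" and "z < 1"
  shows "0 < z" "frac ((- real s) ^ n * z) < z"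
proof -
  note gap = gap_segment[OF assms(1-7)]
  then show "0 < z" by simp
  have "frac ((- real s) ^ n * z) = (- real s) ^ n * z - of_int k"
    using gap assms(8) by (subst frac_unique_iff) auto
  then show "frac ((- real s) ^ n * z) < z" using gap by simp
qed

text \<open>Indeed \<open>-s x = x - s\<close> for \<open>x = s / (s + 1)\<close>.\<close>

lemma top_fixed:
  assumes "2 \<le> s"
  shows "frac ((- real s) ^ n * (real s / (real s + 1))) = real s / (real s + 1)"
proof (induction n)
  case 0
  show ?case by (simp add: frac_eq)
next
  case (Suc n)
  let ?e = "real s / (real s + 1)"
  have "(- real s) ^ Suc n * ?e - (- real s) ^ n * ?e = - ((- real s) ^ n * ((real s + 1) * ?e))"
    by (simp only: power_Suc) algebra
  also have "(real s + 1) * ?e = real s" by simp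
  also have "- ((- real s) ^ n * real s) \<in> \<int>"
    by (intro Ints_minus Ints_mult Ints_power Ints_of_nat)
  finally show ?case using frac_of_int_diff_eq Suc by metis
qed

lemma top_bounds:
  assumes "2 \<le> s"
  shows "0 < real s / (real s + 1)" "real s / (real s + 1) < 1"
  using assms by (auto simp: field_simps)

lemma top_not_matching:
  assumes s: "2 \<le> s"
  shows "real s / (real s + 1) \<notin> matching_set s"
  using frac_less_if_matching[OF s top_bounds[OF s]] top_fixed[OF s] by (metis less_irrefl)

text \<open>Both boundary points have this form, with \<open>m\<close> even on the right and odd on the left: \<open>x\<close> is the
fixed point of the branch of multiplication by \<open>(-s)\<^sup>m\<close> that vanishes at \<open>\<xi>\<close>. The points between
\<open>\<xi>\<close> and \<open>x\<close> lie in a gap. If \<open>x\<close> were a matching parameter, the criterion would hold at \<open>x\<close> with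
some exponent \<open>r\<close>, which by periodicity may be taken less than \<open>m\<close>; the gap of that branch would
connect \<open>x\<close> inside the matching set to an \<open>s\<close>-adic rational \<open>\<eta>\<close> with denominator at most \<open>s\<^sup>r\<close>. By the
minimality of the denominator of \<open>\<xi>\<close>, then \<open>s\<^sup>r \<xi>\<close> is an integer, and by the minimality of \<open>m\<close>
within its parity class, \<open>m = r + 1\<close>. In that one remaining case the fractional part is computed
to be \<open>1 - x / s\<close>, which is less than \<open>x\<close> only beyond \<open>s / (s + 1)\<close>.

The gaps never cross \<open>s / (s + 1)\<close>, since that point is not a matching parameter.\<close>

lemma fixed_point_endpoint:
  fixes V :: "real set"
  assumes s: "2 \<le> s" and V: "matching_interval s V" and pc: "pseudocenter s V \<xi>"
    and m: "1 \<le> m" "real s ^ m * \<xi> \<in> \<int>"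
    and least: "\<And>n. even n = even m \<Longrightarrow> real s ^ n * \<xi> \<in> \<int> \<Longrightarrow> m \<le> n"
    and x: "x = (- real s) ^ m * \<xi> / ((- real s) ^ m - 1)"
  shows "x \<notin> matching_set s" and "closed_segment \<xi> x - {x} \<subseteq> V"
proof -
  let ?e = "real s / (real s + 1)"
  define D where "D = - real s"
  have D0: "D \<noteq> 0" using s by (simp add: D_def)
  have abs_int: "real s ^ n * y \<in> \<int> \<longleftrightarrow> D ^ n * y \<in> \<int>" for n y
    by (auto simp: D_def power_minus[of "real s"] minus_one_power_iff dest: Ints_minus)
  have comp: "V \<in> components ({0..?e} \<inter> matching_set s)"
    using V by (simp add: matching_interval_def bifurcation_set_def Diff_eq)
  have \<xi>V: "\<xi> \<in> V" using pc by (simp add: pseudocenter_def)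
  then have \<xi>: "0 \<le> \<xi>" "\<xi> \<le> ?e" "\<xi> \<in> matching_set s"
    using in_components_subset[OF comp] by auto
  have "\<xi> \<noteq> 0" using zero_not_matching[OF s] \<xi> by auto
  then have \<xi>0: "0 < \<xi>" using \<xi> by simp
  note e = top_bounds[OF s]
  obtain K where K: "D ^ m * \<xi> = of_int K" using m(2) abs_int by (auto elim: Ints_cases)
  have D1: "D ^ m > 1 \<or> D ^ m < 0" using neg_power_cases[OF s m(1)] s by (simp add: D_def)
  then have "D ^ m - 1 \<noteq> 0" by linarith
  then have "(D ^ m - 1) * x = of_int K" unfolding x D_def[symmetric] K by simp
  then have xK: "D ^ m * x - of_int K = x" by (simp add: algebra_simps)
  have "0 < D ^ m / (D ^ m - 1)"
    using D1
  proof
    assume "1 < D ^ m"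
    then show ?thesis by (intro divide_pos_pos) linarith+
  next
    assume "D ^ m < 0"
    then show ?thesis by (intro divide_neg_neg) linarith+
  qed
  moreover have "x = \<xi> * (D ^ m / (D ^ m - 1))"
    unfolding x D_def[symmetric] by (simp only: times_divide_eq_right mult.commute[of \<xi> "D ^ m"])
  ultimately have x0: "0 < x" using \<xi>0 by (simp only: mult_pos_pos)
  have gap1: "0 < z \<and> frac (D ^ m * z) < z" if "z \<in> closed_segment \<xi> x" "z \<noteq> x" "z < 1" for z
    using gap_frac_less[OF s m(1), of \<xi> K x z] that K xK x0 by (simp add: D_def)
  have xe: "x \<le> ?e"
  proof (rule ccontr)
    assume "\<not> x \<le> ?e"
    then have "?e \<in> closed_segment \<xi> x" "?e \<noteq> x" using \<xi> by (auto simp: closed_segment_eq_real_ivl)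
    then show False using gap1 e top_fixed[OF s, of m] unfolding D_def by force
  qed
  then have x1: "x < 1" using e(2) by linarith
  have below_e: "z \<le> ?e" if "z \<in> closed_segment a b" "a \<le> ?e" "b \<le> ?e" for a b z
    using that by (auto simp: closed_segment_eq_real_ivl split: if_splits)
  have seg1: "closed_segment \<xi> x - {x} \<subseteq> {0..?e} \<inter> matching_set s"
  proof
    fix z assume z: "z \<in> closed_segment \<xi> x - {x}"
    then have "z \<le> ?e" using below_e \<xi> xe by blast
    moreover have "0 < z \<and> frac (D ^ m * z) < z" using gap1[of z] z \<open>z \<le> ?e\<close> e by auto
    ultimately show "z \<in> {0..?e} \<inter> matching_set s"
      using matching_if_frac_less[OF s, of z m] e m(1) by (auto simp: D_def)
  qed
  have absorb: "T \<subseteq> V" if "connected T" "\<xi> \<in> T" "T \<subseteq> {0..?e} \<inter> matching_set s" for T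
    using components_maximal[OF comp that(1,3)] that(2) \<xi>V by blast
  have \<xi>x: "\<xi> \<noteq> x"
    using xK K x0 by auto
  have "closed_segment \<xi> x - {x} = (if \<xi> \<le> x then {\<xi>..<x} else {x<..\<xi>})"
    by (auto simp: closed_segment_eq_real_ivl)
  then have "connected (closed_segment \<xi> x - {x})" by simp
  then show "closed_segment \<xi> x - {x} \<subseteq> V" using absorb seg1 \<xi>x by auto
  show "x \<notin> matching_set s"
  proof
    assume xm: "x \<in> matching_set s"
    then obtain n where n: "frac (D ^ n * x) < x"
      using frac_less_if_matching[OF s x0] x1 by (auto simp: D_def)
    have fx: "frac x = x" using x0 x1 by (simp add: frac_eq)
    \<comment> \<open>Multiplication by \<open>D\<^sup>m\<close> fixes \<open>x\<close> modulo \<open>1\<close>, so the exponent only matters modulo \<open>m\<close>.\<close>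
    define r where "r = n mod m"
    have "frac (D ^ (r + m * q) * x) = frac (D ^ r * x)" for q
    proof (induction q)
      case (Suc q)
      have "D ^ (r + m * Suc q) * x - D ^ (r + m * q) * x = D ^ (r + m * q) * (D ^ m * x - x)"
        by (simp add: power_add algebra_simps)
      also have "D ^ m * x - x = of_int K" using xK by simp
      also have "D ^ (r + m * q) * of_int K \<in> \<int>" unfolding D_def by (intro Ints_mult Ints_power Ints_minus) auto
      finally show ?case using frac_of_int_diff_eq Suc by metis
    qed simp
    from this[of "n div m"] have "frac (D ^ n * x) = frac (D ^ r * x)" by (simp add: r_def)
    with n have rx: "frac (D ^ r * x) < x" by simp
    then have "r \<noteq> 0" using fx by (cases "r = 0") auto
    then have r: "1 \<le> r" "r < m" using m(1) by (auto simp: r_def)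
    define k where "k = \<lfloor>D ^ r * x\<rfloor>"
    define \<eta> where "\<eta> = of_int k / D ^ r"
    have \<eta>k: "D ^ r * \<eta> = of_int k" using D0 by (simp add: \<eta>_def)
    have gx: "0 \<le> D ^ r * x - of_int k" "D ^ r * x - of_int k < x"
      using rx by (auto simp: k_def frac_def)
    have gap2: "0 < z \<and> frac (D ^ r * z) < z" if "z \<in> closed_segment \<eta> x" "z < 1" for z
      using gap_frac_less[OF s r(1), of \<eta> k x z] that \<eta>k gx by (simp add: D_def)
    \<comment> \<open>For odd \<open>r\<close> the zero \<open>\<eta>\<close> lies to the right of \<open>x\<close> and might leave the parameter range.\<close>
    have "\<eta> \<le> ?e"
    proof (rule ccontr)
      assume "\<not> \<eta> \<le> ?e"
      then have "?e \<in> closed_segment \<eta> x" using xe by (auto simp: closed_segment_eq_real_ivl)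
      then show False using gap2 e top_fixed[OF s, of r] unfolding D_def by force
    qed
    have seg2: "closed_segment \<eta> x \<subseteq> {0..?e} \<inter> matching_set s"
    proof
      fix z assume z: "z \<in> closed_segment \<eta> x"
      then have "z \<le> ?e" using below_e \<open>\<eta> \<le> ?e\<close> xe by blast
      moreover have "0 < z \<and> frac (D ^ r * z) < z" using gap2[of z] z \<open>z \<le> ?e\<close> e by auto
      ultimately show "z \<in> {0..?e} \<inter> matching_set s"
        using matching_if_frac_less[OF s, of z r] e r(1) by (auto simp: D_def)
    qed
    have "closed_segment \<xi> x \<union> closed_segment \<eta> x \<subseteq> V"
    proof (rule absorb)
      show "connected (closed_segment \<xi> x \<union> closed_segment \<eta> x)"
        by (intro connected_Un) auto
      show "closed_segment \<xi> x \<union> closed_segment \<eta> x \<subseteq> {0..?e} \<inter> matching_set s"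
        using seg1 seg2 ends_in_segment(2)[of x \<eta>] by blast
    qed auto
    then have "\<eta> \<in> V" by auto
    have \<eta>_form: "\<exists>p::int. \<eta> = of_int p / real s ^ r"
    proof -
      have "real s ^ r * \<eta> \<in> \<int>" using abs_int \<eta>k by simp
      then obtain p where "real s ^ r * \<eta> = of_int p" by (auto elim: Ints_cases)
      then show ?thesis using s by (intro exI[of _ p]) (simp add: field_simps)
    qed
    define M where "M = (LEAST m. \<exists>p::int. \<xi> = of_int p / real s ^ m)"
    have "\<exists>m. \<exists>p::int. \<xi> = of_int p / real s ^ m" using pc by (auto simp: pseudocenter_def sadic_rational_def)
    then have "\<exists>p::int. \<xi> = of_int p / real s ^ M" unfolding M_def by (rule LeastI_ex)
    then obtain p where p: "\<xi> = of_int p / real s ^ M" by blast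
    have "sadic_denom s \<xi> \<le> sadic_denom s \<eta>"
      using pc \<open>\<eta> \<in> V\<close> \<eta>_form by (auto simp: pseudocenter_def sadic_rational_def)
    then have "M \<le> (LEAST m. \<exists>p::int. \<eta> = of_int p / real s ^ m)"
      using s by (simp add: sadic_denom_def M_def)
    also have "\<dots> \<le> r" by (rule Least_le) (rule \<eta>_form)
    finally have "M \<le> r" .
    have "real s ^ r * \<xi> = real s ^ (r - M) * of_int p"
      using s p \<open>M \<le> r\<close> by (simp add: power_diff)
    also have "\<dots> \<in> \<int>" by (intro Ints_mult Ints_power) auto
    finally have r_int: "real s ^ r * \<xi> \<in> \<int>" .
    then have "even r \<noteq> even m" using least[of r] r by auto
    moreover have "real s ^ Suc r * \<xi> \<in> \<int>" using Ints_mult[OF _ r_int, of "real s"] by (simp add: mult.assoc)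
    ultimately have "m = Suc r" using least[of "Suc r"] r by simp
    obtain p' where p': "D ^ r * \<xi> = of_int p'" using r_int abs_int by (auto elim: Ints_cases)
    \<comment> \<open>The fixed point equation for \<open>D\<^sup>m\<close>, divided by \<open>D\<close>, gives \<open>D\<^sup>r x\<close> modulo \<open>1\<close>.\<close>
    have "D * (D ^ r * x) = D * of_int p' + x"
      using xK K p' \<open>m = Suc r\<close> by (simp add: mult.assoc)
    then have "D ^ r * x = of_int p' + x / D" using D0 by (simp add: field_simps)
    also have "\<dots> = of_int (p' - 1) + (1 - x / real s)" by (simp add: D_def)
    finally have "frac (D ^ r * x) = frac (1 - x / real s)" by (simp add: frac_of_int_diff_eq)
    also have "\<dots> = 1 - x / real s"
      using x0 x1 s by (subst frac_eq) (auto simp: field_simps)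
    finally have "1 - x / real s < x" using rx by simp
    then have "?e < x" using s by (simp add: field_simps)
    then show False using xe by simp
  qed
qed

section \<open>Finite words and periodic expansions\<close>

lemma word_value_Nil [simp]: "word_value s [] = 0"
  by (simp add: word_value_def)

lemma word_value_Cons: "word_value s (a # u) = (real a + word_value s u) / real s"
  unfolding word_value_def by (simp add: sum.lessThan_Suc_shift sum_divide_distrib add_divide_distrib mult.commute del: sum.lessThan_Suc)

lemma word_value_append: "word_value s (u @ v) = word_value s u + word_value s v / real s ^ length u"
  by (induction u) (auto simp: word_value_Cons add_divide_distrib mult.commute)

lemma word_value_bounds:
  assumes "set u \<subseteq> {..<s}"
  shows "0 \<le> word_value s u" and "word_value s u \<le> 1 - 1 / real s ^ length u"
proof -
  show "0 \<le> word_value s u" by (simp add: word_value_def sum_nonneg)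
  show "word_value s u \<le> 1 - 1 / real s ^ length u"
    using assms
  proof (induction u)
    case (Cons a u)
    then have "real a + word_value s u \<le> (real s - 1) + (1 - 1 / real s ^ length u)"
      by (intro add_mono) auto
    then have "word_value s (a # u) \<le> (real s - 1 / real s ^ length u) / real s"
      unfolding word_value_Cons by (intro divide_right_mono) auto
    also have "\<dots> = 1 - 1 / real s ^ length (a # u)" using Cons.prems by (auto simp: field_simps)
    finally show ?case .
  qed simp
qed

lemma word_neg_digits: "2 \<le> s \<Longrightarrow> set (word_neg s u) \<subseteq> {..<s}"
  by (auto simp: word_neg_def)

lemma word_neg_neg:
  assumes "set u \<subseteq> {..<s}"
  shows "word_neg s (word_neg s u) = u"
  using assms by (induction u) (auto simp: word_neg_def)

lemma word_value_neg:
  assumes "set u \<subseteq> {..<s}"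
  shows "word_value s (word_neg s u) = 1 - 1 / real s ^ length u - word_value s u"
  using assms
proof (induction u)
  case (Cons a u)
  then have "a < s" "0 < s" by auto
  then have "word_value s (word_neg s (a # u)) = (real s - 1 - real a + (1 - 1 / real s ^ length u - word_value s u)) / real s"
    using Cons by (simp add: word_neg_def word_value_Cons of_nat_diff)
  also have "\<dots> = 1 - 1 / real s ^ length (a # u) - word_value s (a # u)"
    using \<open>0 < s\<close> by (simp add: word_value_Cons field_simps)
  finally show ?case .
qed (simp add: word_neg_def)

lemma word_less_Cons: "word_less (a # u) (b # v) \<longleftrightarrow> a < b \<or> a = b \<and> word_less u v"
proof
  assume "word_less (a # u) (b # v)"
  then obtain i where i: "i < length (a # u)" "i < length (b # v)"
    "take i (a # u) = take i (b # v)" "(a # u) ! i < (b # v) ! i"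
    unfolding word_less_def by blast
  then show "a < b \<or> a = b \<and> word_less u v"
    by (cases i) (auto simp: word_less_def)
next
  assume "a < b \<or> a = b \<and> word_less u v"
  then show "word_less (a # u) (b # v)"
  proof
    assume "a < b"
    then show ?thesis unfolding word_less_def by (intro exI[of _ 0]) simp
  next
    assume "a = b \<and> word_less u v"
    then obtain i where "a = b" "i < length u" "i < length v" "take i u = take i v" "u ! i < v ! i"
      unfolding word_less_def by blast
    then show ?thesis unfolding word_less_def by (intro exI[of _ "Suc i"]) simp
  qed
qed

lemma word_less_cases:
  obtains "word_less u v" | "word_less v u" | r where "v = u @ r" | r where "u = v @ r"
proof -
  have "word_less u v \<or> word_less v u \<or> (\<exists>r. v = u @ r) \<or> (\<exists>r. u = v @ r)"
  proof (induction u arbitrary: v)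
    case (Cons a u)
    then show ?case by (cases v) (auto simp: word_less_Cons)
  qed simp
  then show ?thesis using that by blast
qed

lemma word_value_less:
  assumes "word_less u v" "set u \<subseteq> {..<s}"
  shows "word_value s u < word_value s v"
  using assms
proof (induction u arbitrary: v)
  case (Cons a u)
  then obtain b v' where v: "v = b # v'" by (cases v) (auto simp: word_less_def)
  have "0 < s" using Cons.prems by auto
  have "real a + word_value s u < real b + word_value s v'"
  proof (cases "a < b")
    case True
    have "0 < 1 / real s ^ length u" using \<open>0 < s\<close> by simp
    moreover have "word_value s u \<le> 1 - 1 / real s ^ length u"
      using Cons.prems by (intro word_value_bounds) auto
    ultimately have "word_value s u < 1" by linarith
    moreover have "0 \<le> word_value s v'" by (simp add: word_value_def sum_nonneg)
    ultimately show ?thesis using True by linarith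
  next
    case False
    then show ?thesis using Cons v by (auto simp: word_less_Cons)
  qed
  then show ?case using \<open>0 < s\<close> by (simp add: v word_value_Cons divide_strict_right_mono)
qed (simp add: word_less_def)

lemma word_less_neg:
  assumes "word_less u v" "set v \<subseteq> {..<s}"
  shows "word_less (word_neg s v) (word_neg s u)"
proof -
  obtain i where i: "i < length u" "i < length v" "take i u = take i v" "u ! i < v ! i"
    using assms(1) unfolding word_less_def by blast
  then have "v ! i < s" using assms(2) nth_mem by blast
  then show ?thesis unfolding word_less_def word_neg_def
    using i by (intro exI[of _ i]) (auto simp: take_map)
qed

lemma sadic_expansion_exists:
  assumes "0 < s" "0 \<le> x" "x < 1" "real s ^ n * x \<in> \<int>"
  shows "\<exists>u. sadic_expansion s u x \<and> length u = n"
  using assms(2-)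
proof (induction n arbitrary: x)
  case 0
  then have "x = 0" by (metis Ints_0 frac_eq frac_eq_0_iff mult_1 power_0)
  then show ?case by (simp add: sadic_expansion_def)
next
  case (Suc n)
  have "real s ^ n * frac (real s * x) = real s ^ Suc n * x - real s ^ n * of_int \<lfloor>real s * x\<rfloor>"
    by (simp add: frac_def algebra_simps)
  also have "\<dots> \<in> \<int>" by (intro Ints_diff[OF Suc.prems(3)] Ints_mult Ints_power) auto
  finally obtain u where u: "sadic_expansion s u (frac (real s * x))" "length u = n"
    using Suc.IH[of "frac (real s * x)"] by (auto simp: frac_lt_1)
  define a where "a = nat \<lfloor>real s * x\<rfloor>"
  have a: "real a = of_int \<lfloor>real s * x\<rfloor>" using Suc.prems assms(1) by (simp add: a_def)
  have "real s * x < real s * 1" using Suc.prems assms(1) by (intro mult_strict_left_mono) auto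
  then have "real a < real s" unfolding a by linarith
  then have "sadic_expansion s (a # u) x"
  proof -
    have "set u \<subseteq> {..<s}" "word_value s u = real s * x - real a"
      using u(1) a by (auto simp: sadic_expansion_def frac_def)
    then show ?thesis using \<open>real a < real s\<close> assms(1) by (simp add: sadic_expansion_def word_value_Cons)
  qed
  then show ?case using u(2) by (intro exI[of _ "a # u"]) simp
qed

lemma sadic_expansion_Ints:
  assumes "0 < s" "sadic_expansion s u x"
  shows "real s ^ length u * x \<in> \<int>"
proof -
  have "real s ^ length u * word_value s u \<in> \<int>"
  proof (induction u)
    case (Cons a u)
    have "real s ^ length (a # u) * word_value s (a # u) = real s ^ length u * real a + real s ^ length u * word_value s u"
      using assms(1) by (simp add: word_value_Cons field_simps)
    then show ?case using Cons by (metis Ints_add Ints_mult Ints_of_nat Ints_power)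
  qed simp
  then show ?thesis using assms(2) by (simp add: sadic_expansion_def)
qed

text \<open>A shift by one period reproduces the series up to the factor \<open>s\<^sup>n\<close>, so the value \<open>P\<close> solves
\<open>P = W + P / s\<^sup>n\<close>, where \<open>n\<close> is the length of the word and \<open>W\<close> its value.\<close>

lemma periodic_value_eq:
  assumes s: "2 \<le> s" and u: "u \<noteq> []" "set u \<subseteq> {..<s}"
  shows "periodic_value s u = real s ^ length u * word_value s u / (real s ^ length u - 1)"
proof -
  define n where "n = length u"
  define f where "f = (\<lambda>i. real (u ! (i mod n)) / real s ^ Suc i)"
  have n: "0 < n" using u by (simp add: n_def)
  have s1: "2 \<le> real s ^ n" using neg_power_cases(1)[OF s, of n] n by simp
  have "summable (\<lambda>i. real s * (1 / real s) ^ Suc i)"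
    using s by (intro summable_mult summable_Suc_iff[THEN iffD2] summable_geometric) auto
  then have sum: "summable f"
  proof (rule summable_comparison_test_ev[rotated], intro always_eventually allI)
    fix i
    have "u ! (i mod n) < s" using u n by (metis in_mono lessThan_iff mod_less_divisor n_def nth_mem)
    then show "norm (f i) \<le> real s * (1 / real s) ^ Suc i"
      using s by (simp add: f_def power_divide divide_right_mono field_simps)
  qed
  have "f (i + n) = f i / real s ^ n" for i by (simp add: f_def power_add)
  then have "(\<Sum>i. f (i + n)) = (\<Sum>i. f i) / real s ^ n" using sum by (simp add: suminf_divide)
  moreover have "(\<Sum>i. f i) = (\<Sum>i. f (i + n)) + (\<Sum>i<n. f i)" using sum by (rule suminf_split_initial_segment)
  moreover have "(\<Sum>i<n. f i) = word_value s u"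
    unfolding word_value_def f_def n_def[symmetric] by (intro sum.cong) auto
  moreover have "periodic_value s u = (\<Sum>i. f i)" by (simp add: periodic_value_def f_def n_def)
  ultimately have "periodic_value s u = periodic_value s u / real s ^ n + word_value s u" by simp
  then have "periodic_value s u * real s ^ n = (periodic_value s u / real s ^ n + word_value s u) * real s ^ n"
    by simp
  also have "\<dots> = periodic_value s u + real s ^ n * word_value s u" using s1 s by (simp add: algebra_simps)
  finally show ?thesis using s1 s unfolding n_def[symmetric] by (simp add: field_simps)
qed

theorem theorem5:
  fixes s :: nat and V :: "real set" and \<xi> :: real and v w :: "nat list"
  assumes "s \<ge> 2"
    and "matching_interval s V"
    and "pseudocenter s V \<xi>"
    and "shortest_even_expansion s w \<xi>"
    and "shortest_odd_expansion s v (1 - \<xi>)"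
  shows "\<exists>\<xi>L \<xi>R. frontier V = {\<xi>L, \<xi>R} \<and> \<xi>L < \<xi>R \<and>
           \<xi>L = periodic_value s (word_neg s v @ v) \<and>
           \<xi>R = periodic_value s w \<and>
           word_less (word_neg s w) v \<and> word_less (word_neg s v) w"
proof -
  note s = assms(1)
  let ?e = "real s / (real s + 1)"
  have comp: "V \<in> components ({0..?e} \<inter> matching_set s)"
    using assms(2) by (simp add: matching_interval_def bifurcation_set_def Diff_eq)
  have \<xi>V: "\<xi> \<in> V" using assms(3) by (simp add: pseudocenter_def)
  then have \<xi>: "0 \<le> \<xi>" "\<xi> \<le> ?e" "\<xi> \<in> matching_set s"
    using in_components_subset[OF comp] by auto
  have "\<xi> \<noteq> 0" using zero_not_matching[OF s] \<xi> by auto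
  with \<xi> have \<xi>0: "0 < \<xi>" "\<xi> < 1" using top_bounds(2)[OF s] by linarith+
  have w: "set w \<subseteq> {..<s}" "word_value s w = \<xi>" "even (length w)"
    and v: "set v \<subseteq> {..<s}" "word_value s v = 1 - \<xi>" "odd (length v)"
    using assms(4,5) by (auto simp: shortest_even_expansion_def shortest_odd_expansion_def sadic_expansion_def)
  have "w \<noteq> []" using w \<xi>0 by auto
  then have lw: "1 \<le> length w" by (cases w) auto
  have lv: "1 \<le> length v" using v(3) by (cases v) auto
  define xR where "xR = (- real s) ^ length w * \<xi> / ((- real s) ^ length w - 1)"
  define xL where "xL = (- real s) ^ length v * \<xi> / ((- real s) ^ length v - 1)"
  have w_int: "real s ^ length w * \<xi> \<in> \<int>"
    using sadic_expansion_Ints[of s w \<xi>] s w by (auto simp: sadic_expansion_def)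
  have w_least: "length w \<le> n" if "even n = even (length w)" "real s ^ n * \<xi> \<in> \<int>" for n
    using sadic_expansion_exists[of s \<xi> n] s \<xi>0 that w(3) assms(4) by (auto simp: shortest_even_expansion_def)
  have flip: "real s ^ n * (1 - \<xi>) \<in> \<int> \<longleftrightarrow> real s ^ n * \<xi> \<in> \<int>" for n
  proof -
    have "real s ^ n * (1 - \<xi>) = real s ^ n - real s ^ n * \<xi>" by (simp add: algebra_simps)
    moreover have "real s ^ n \<in> \<int>" by (intro Ints_power) auto
    ultimately show ?thesis by (metis Ints_diff diff_diff_eq2 add_diff_cancel_left')
  qed
  have v_int: "real s ^ length v * \<xi> \<in> \<int>"
    using sadic_expansion_Ints[of s v "1 - \<xi>"] s v flip by (auto simp: sadic_expansion_def)
  have v_least: "length v \<le> n" if "even n = even (length v)" "real s ^ n * \<xi> \<in> \<int>" for n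
    using sadic_expansion_exists[of s "1 - \<xi>" n] s \<xi>0 that v(3) assms(5) flip by (auto simp: shortest_odd_expansion_def)
  note R = fixed_point_endpoint[OF assms(1-3) lw w_int w_least xR_def]
  note L = fixed_point_endpoint[OF assms(1-3) lv v_int v_least xL_def]
  have sw: "2 \<le> real s ^ length w" and sv: "2 \<le> real s ^ length v"
    using neg_power_cases(1)[OF s] lw lv by auto
  have xR: "xR = real s ^ length w * \<xi> / (real s ^ length w - 1)"
    using w(3) by (simp add: xR_def)
  have xL: "xL = real s ^ length v * \<xi> / (real s ^ length v + 1)"
  proof -
    have "xL = - (real s ^ length v * \<xi>) / - (real s ^ length v + 1)" using v(3) by (simp add: xL_def)
    then show ?thesis by (simp only: minus_divide_divide)
  qed
  have "\<xi> < xR" using \<xi>0 sw by (simp add: xR field_simps)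
  have "xL < \<xi>" using \<xi>0 sv by (simp add: xL field_simps)
  have "V \<subseteq> {xL<..<xR}"
  proof
    fix z assume z: "z \<in> V"
    have conn: "connected V" using in_components_connected[OF comp] .
    have "xL \<notin> V" "xR \<notin> V" using R(1) L(1) in_components_subset[OF comp] by auto
    then have "\<not> z \<le> xL" "\<not> xR \<le> z"
      using connectedD_interval[OF conn z \<xi>V, of xL] connectedD_interval[OF conn \<xi>V z, of xR]
        \<open>\<xi> < xR\<close> \<open>xL < \<xi>\<close> by auto
    then show "z \<in> {xL<..<xR}" by simp
  qed
  moreover have "{xL<..<xR} \<subseteq> (closed_segment \<xi> xL - {xL}) \<union> (closed_segment \<xi> xR - {xR})"
    using \<open>\<xi> < xR\<close> \<open>xL < \<xi>\<close> by (auto simp: closed_segment_eq_real_ivl)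
  ultimately have "V = {xL<..<xR}" using R(2) L(2) by blast
  then have front: "frontier V = {xL, xR}" using \<open>\<xi> < xR\<close> \<open>xL < \<xi>\<close> by (auto simp: frontier_def)
  have xR_per: "xR = periodic_value s w"
    unfolding periodic_value_eq[OF s \<open>w \<noteq> []\<close> w(1)] by (simp add: xR w)
  have neg: "set (word_neg s v) \<subseteq> {..<s}" "length (word_neg s v) = length v"
    using word_neg_digits[OF s] by (auto simp: word_neg_def)
  have neg_val: "word_value s (word_neg s v) = \<xi> - 1 / real s ^ length v"
    using word_value_neg[OF v(1)] v(2) by simp
  have xL_per: "xL = periodic_value s (word_neg s v @ v)"
  proof -
    define S where "S = real s ^ length v"
    have S: "2 \<le> S" using sv by (simp add: S_def)
    have "periodic_value s (word_neg s v @ v) =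
        S * S * (\<xi> - 1 / S + (1 - \<xi>) / S) / (S * S - 1)"
    proof -
      have "word_neg s v @ v \<noteq> []" "set (word_neg s v @ v) \<subseteq> {..<s}" using lv neg v(1) by auto
      from periodic_value_eq[OF s this] show ?thesis
        by (simp add: neg v(2) word_value_append neg_val S_def power_add)
    qed
    also have "S * S * (\<xi> - 1 / S + (1 - \<xi>) / S) = S * \<xi> * (S - 1)"
      using S by (simp add: field_simps)
    also have "S * S - 1 = (S + 1) * (S - 1)" by (simp add: algebra_simps)
    also have "S * \<xi> * (S - 1) / ((S + 1) * (S - 1)) = xL" using S by (simp add: xL S_def)
    finally show ?thesis by simp
  qed
  \<comment> \<open>The value of \<open>word_neg s v\<close> is below that of \<open>w\<close> by exactly one unit of the last place of \<open>v\<close>. This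
    rules out the reverse order and both prefix cases: appending digits adds less than one unit.\<close>
  have less: "word_less (word_neg s v) w"
  proof (cases rule: word_less_cases[of "word_neg s v" w])
    case 2
    then show ?thesis using word_value_less[OF _ w(1)] w(2) neg_val sv by force
  next
    case (3 r)
    then have "set r \<subseteq> {..<s}" using w(1) by auto
    then have "word_value s r \<le> 1 - 1 / real s ^ length r" by (rule word_value_bounds)
    moreover have "0 < 1 / real s ^ length r" using s by simp
    ultimately have "word_value s r < 1" by linarith
    moreover have "\<xi> = \<xi> - 1 / real s ^ length v + word_value s r / real s ^ length v"
      using w(2) 3 neg neg_val by (simp add: word_value_append)
    then have "word_value s r = 1" using sv s by (simp add: field_simps)
    ultimately show ?thesis by simp
  next
    case (4 r)
    then have "set r \<subseteq> {..<s}" using neg(1) by auto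
    then have "0 \<le> word_value s r" by (rule word_value_bounds)
    then have "word_value s w \<le> word_value s (word_neg s v)" using s by (simp add: 4 word_value_append)
    moreover have "0 < 1 / real s ^ length v" using s by simp
    ultimately show ?thesis using neg_val w(2) by linarith
  qed
  then have "word_less (word_neg s w) v"
    using word_less_neg[OF less w(1)] word_neg_neg[OF v(1)] by simp
  then show ?thesis using front xR_per xL_per less \<open>\<xi> < xR\<close> \<open>xL < \<xi>\<close> by force
qed

end
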